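(* Consider the scheduling problem $P\mid a_i\in\{0,1\},\,X_j\sim\mathrm{stoch}\mid \mathbb{E}[\sum_j w_jC_j]$, and suppose every $X_j$ is integer-valued and there is $\Delta\ge0$ with $\mathrm{Var}[X_j]\le\Delta\,\mathbb{E}[X_j]^2$ for all $j$. Then the WSEPT policy achieves a performance guarantee of $1+\frac12(\sqrt2-1)(1+\Delta)$ in the class of non-preemptive policies, i.e. $\mathbb{E}[\sum_jw_jC_j^{\mathrm{WSEPT}}]\le\big(1+\frac12(\sqrt2-1)(1+\Delta)\big)\,\mathbb{E}[\sum_jw_jC_j^{\pi}]$ for every non-preemptive non-anticipatory policy $\pi$.
   Context: $P\mid a_i\in\{0,1\},X_j\sim\mathrm{stoch}\mid\mathbb{E}[\sum w_jC_j]$: there are $m$ identical parallel machines, machine $i$ has an arrival time $a_i\in\{0,1\}$ and cannot be used before it; there are $n$ jobs with positive weights $w_j$ and independent positive random processing times $X_j$ with known distributions, realizations revealed only upon completion. Each machine processes at most one job at a time. A non-preemptive policy processes each job without interruption on one machine once started, and is non-anticipatory (decisions depend only on the past and on the distributions, not on realizations of unfinished jobs). The goal is to minimize the expected total weighted completion time. WSEPT is the non-preemptive list-scheduling policy that, whenever a machine has arrived and is idle, starts the unstarted job with largest ratio $w_j/\mathbb{E}[X_j]$. *)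

theory Defs
  imports "HOL-Probability.Probability"
begin

text \<open>
  Jobs are \<open>0, \<dots>, n - 1\<close>, machines are \<open>0, \<dots>, m - 1\<close>, and machine \<open>i\<close> arrives at time \<open>a i\<close>.
  A realization is a vector of processing times; only its entries below \<open>n\<close> matter.
  A policy is represented by the schedule it produces on each realization.
\<close>

record schedule =
  machine :: "nat \<Rightarrow> nat"
  start :: "nat \<Rightarrow> real"

type_synonym realization = "nat \<Rightarrow> real"
type_synonym policy = "realization \<Rightarrow> schedule"

definition realizations :: "nat \<Rightarrow> realization set" where
  "realizations n = {x. \<forall>j<n. 0 < x j}"

definition completion :: "realization \<Rightarrow> schedule \<Rightarrow> nat \<Rightarrow> real" where
  "completion x s j = start s j + x j"

definition feasible_schedule ::
  "nat \<Rightarrow> nat \<Rightarrow> (nat \<Rightarrow> real) \<Rightarrow> realization \<Rightarrow> schedule \<Rightarrow> bool" where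
  "feasible_schedule m n a x s \<longleftrightarrow>
     (\<forall>j<n. machine s j < m \<and> a (machine s j) \<le> start s j) \<and>
     (\<forall>j<n. \<forall>k<n. j \<noteq> k \<and> machine s j = machine s k \<longrightarrow>
        completion x s j \<le> start s k \<or> completion x s k \<le> start s j)"

text \<open>
  The information available at time \<open>t\<close>, before the decisions at time \<open>t\<close> are taken: all jobs
  started so far, with machines and start times, and the processing times of all jobs completed
  by \<open>t\<close> (inclusive, so that a job may start at the very moment another one completes).
  Of a job still running at \<open>t\<close> one only learns that it is not yet completed.
\<close>

definition history ::
  "nat \<Rightarrow> policy \<Rightarrow> realization \<Rightarrow> real \<Rightarrow> (nat \<times> nat \<times> real) set \<times> (nat \<times> real) set" where
  "history n \<pi> x t =
     ({(j, machine (\<pi> x) j, start (\<pi> x) j) | j. j < n \<and> start (\<pi> x) j < t},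
      {(j, x j) | j. j < n \<and> completion x (\<pi> x) j \<le> t})"

definition decisions :: "nat \<Rightarrow> policy \<Rightarrow> realization \<Rightarrow> real \<Rightarrow> (nat \<times> nat) set" where
  "decisions n \<pi> x t = {(j, machine (\<pi> x) j) | j. j < n \<and> start (\<pi> x) j = t}"

definition non_anticipatory :: "nat \<Rightarrow> policy \<Rightarrow> bool" where
  "non_anticipatory n \<pi> \<longleftrightarrow>
     (\<forall>x\<in>realizations n. \<forall>y\<in>realizations n. \<forall>t.
        history n \<pi> x t = history n \<pi> y t \<longrightarrow> decisions n \<pi> x t = decisions n \<pi> y t)"

text \<open>
  Deliberate idling and start times at arbitrary real points in time are allowed.  No
  measurability is required: processing times taking countably many values make the cost of any
  policy measurable up to a null set.
\<close>

definition nonpreemptive_policy :: "nat \<Rightarrow> nat \<Rightarrow> (nat \<Rightarrow> real) \<Rightarrow> policy \<Rightarrow> bool" where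
  "nonpreemptive_policy m n a \<pi> \<longleftrightarrow>
     (\<forall>x\<in>realizations n. feasible_schedule m n a x (\<pi> x)) \<and> non_anticipatory n \<pi>"

definition busy :: "nat \<Rightarrow> realization \<Rightarrow> schedule \<Rightarrow> nat \<Rightarrow> real \<Rightarrow> bool" where
  "busy n x s i t \<longleftrightarrow> (\<exists>j<n. machine s j = i \<and> start s j \<le> t \<and> t < completion x s j)"

text \<open>
  List scheduling by non-increasing priority \<open>r\<close>.  As \<^const>\<open>busy\<close> takes the jobs started at time
  \<open>t\<close> itself into account, a machine that has arrived and is not busy at \<open>t\<close> witnesses that no
  unstarted job was left at \<open>t\<close>.  Ties in \<open>r\<close> may be broken arbitrarily.
\<close>

definition list_schedule ::
  "nat \<Rightarrow> nat \<Rightarrow> (nat \<Rightarrow> real) \<Rightarrow> (nat \<Rightarrow> real) \<Rightarrow> realization \<Rightarrow> schedule \<Rightarrow> bool" where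
  "list_schedule m n a r x s \<longleftrightarrow>
     (\<forall>t. \<forall>i<m. a i \<le> t \<and> \<not> busy n x s i t \<longrightarrow> (\<forall>j<n. start s j \<le> t)) \<and>
     (\<forall>j<n. \<forall>k<n. start s j < start s k \<longrightarrow> r k \<le> r j)"

definition WSEPT ::
  "'a measure \<Rightarrow> nat \<Rightarrow> nat \<Rightarrow> (nat \<Rightarrow> real) \<Rightarrow> (nat \<Rightarrow> real) \<Rightarrow> (nat \<Rightarrow> 'a \<Rightarrow> real) \<Rightarrow> policy \<Rightarrow> bool"
where
  "WSEPT M m n a w X \<pi> \<longleftrightarrow>
     nonpreemptive_policy m n a \<pi> \<and>
     (\<forall>x\<in>realizations n.
        list_schedule m n a (\<lambda>j. w j / prob_space.expectation M (X j)) x (\<pi> x))"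

text \<open>
  The expected cost is taken in \<open>[0, \<infinity>]\<close>, since a policy may have infinite expected cost.
\<close>

definition expected_cost ::
  "'a measure \<Rightarrow> nat \<Rightarrow> (nat \<Rightarrow> real) \<Rightarrow> (nat \<Rightarrow> 'a \<Rightarrow> real) \<Rightarrow> policy \<Rightarrow> ennreal" where
  "expected_cost M n w X \<pi> =
     (\<integral>\<^sup>+ \<omega>. ennreal (\<Sum>j<n. w j * completion (\<lambda>j. X j \<omega>) (\<pi> (\<lambda>j. X j \<omega>)) j) \<partial>M)"

end

theory Submission
  imports Defs
begin

text \<open>
  Write \<open>\<mu> j\<close> for the mean of \<open>X j\<close>, \<open>r j = w j / \<mu> j\<close> and \<open>kk = (1 + sqrt 2) / 2\<close>.  A start time is
  independent of the processing time of its job, so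
  \<open>E (\<Sum>j. w j * S j) = E (\<Sum>j. r j * X j * S j)\<close>, and it suffices to compare the schedules
  realization by realization with the weights \<open>r j * x j\<close>; passing back and forth between
  \<open>\<Sum>j. r j * E (X j\<^sup>2)\<close> and \<open>\<Sum>j. r j * (\<mu> j)\<^sup>2\<close> costs the factor \<open>1 + \<Delta>\<close>.  Splitting the weights along the
  level sets of \<open>r\<close> reduces the comparison to weights \<open>x j\<close>, for which any greedy schedule has to be shown
  to be \<open>kk\<close>-approximate.

  For weights \<open>x j\<close>, twice the cost of a schedule without idle time is
  \<open>(\<Sum>i. (L i)\<^sup>2 - (a i)\<^sup>2) + (\<Sum>j. (x j)\<^sup>2)\<close>, where \<open>L i\<close> is the completion time of machine \<open>i\<close>, and this
  is a lower bound for every schedule.  Let \<open>l\<close> be the smallest greedy \<open>L i\<close>; no job starts after \<open>l\<close>.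
  If \<open>l \<ge> 2\<close>, bound the squares of the optimal loads below by their tangents at \<open>\<tau> = sqrt 2 * l\<close>, plus
  \<open>(max 0 (x j - \<tau>))\<^sup>2\<close> for each job; as the total load is the same in both schedules, the claim then
  splits into one inequality per machine.  The cases \<open>l = 0\<close> and \<open>l = 1\<close> are direct.
\<close>

subsection \<open>Jobs on a single machine\<close>

text \<open>Induction in the order of start times: the inserted job starts last, so all others end
  by its start, which serves as their deadline \<open>T\<close>.\<close>

lemma packing_bound:
  fixes S p :: "'b \<Rightarrow> real"
  assumes "finite B" "\<And>j. j \<in> B \<Longrightarrow> 0 < p j" "\<And>j. j \<in> B \<Longrightarrow> a \<le> S j"
    "\<And>j k. j \<in> B \<Longrightarrow> k \<in> B \<Longrightarrow> j \<noteq> k \<Longrightarrow> S j + p j \<le> S k \<or> S k + p k \<le> S j"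
    "\<And>j. j \<in> B \<Longrightarrow> S j + p j \<le> T" "a \<le> T"
  shows "a + sum p B \<le> T"
  using assms
proof (induction B arbitrary: T rule: finite_ranking_induct[where f = S])
  case empty
  then show ?case by simp
next
  case (insert j B)
  show ?case
  proof (cases "j \<in> B")
    case True
    then show ?thesis using insert by (simp add: insert_absorb)
  next
    case False
    have "S k + p k \<le> S j" if "k \<in> B" for k
      using insert.prems(3)[of j k] insert.hyps(2)[of k] insert.prems(1)[of j] that False
      by fastforce
    then have "a + sum p B \<le> S j"
      using insert.prems by (intro insert.IH) auto
    then show ?thesis
      using insert.prems(4)[of j] False insert.hyps(1) by simp
  qed
qed

text \<open>Put \<open>P = a + sum p B\<close>. Appending a job of length \<open>q\<close> raises
  the left side by exactly \<open>2 * q * (P + q)\<close>, and by \<open>packing_bound\<close> this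
  job cannot start before \<open>P\<close>. With weights equal to lengths, the order of the jobs
  therefore does not enter the bound.\<close>

lemma disjoint_jobs_cost_ge:
  fixes S p :: "'b \<Rightarrow> real"
  assumes "finite B" "\<And>j. j \<in> B \<Longrightarrow> 0 < p j" "\<And>j. j \<in> B \<Longrightarrow> a \<le> S j"
    "\<And>j k. j \<in> B \<Longrightarrow> k \<in> B \<Longrightarrow> j \<noteq> k \<Longrightarrow> S j + p j \<le> S k \<or> S k + p k \<le> S j"
  shows "(a + sum p B)\<^sup>2 - a\<^sup>2 + (\<Sum>j\<in>B. (p j)\<^sup>2) \<le> 2 * (\<Sum>j\<in>B. p j * (S j + p j))"
  using assms
proof (induction B rule: finite_ranking_induct[where f = S])
  case empty
  then show ?case by simp
next
  case (insert j B)
  show ?case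
  proof (cases "j \<in> B")
    case True
    then show ?thesis using insert by (simp add: insert_absorb)
  next
    case False
    have "S k + p k \<le> S j" if "k \<in> B" for k
      using insert.prems(3)[of j k] insert.hyps(2)[of k] insert.prems(1)[of j] that False
      by fastforce
    then have "a + sum p B \<le> S j"
      using insert.prems insert.hyps(1) by (intro packing_bound[of B p a S]) auto
    then have "p j * (a + sum p B) \<le> p j * S j"
      using insert.prems(1)[of j] by (intro mult_left_mono) auto
    moreover have "(a + sum p B)\<^sup>2 - a\<^sup>2 + (\<Sum>j\<in>B. (p j)\<^sup>2) \<le> 2 * (\<Sum>j\<in>B. p j * (S j + p j))"
      using insert.prems by (intro insert.IH) auto
    ultimately show ?thesis
      using False insert.hyps(1) by (simp add: power2_eq_square algebra_simps)
  qed
qed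

text \<open>The telescoping of \<open>disjoint_jobs_cost_ge\<close>, reversed. The hypothesis passes
  to \<open>B\<close> because the inserted job starts last and lies in none of the sets of earlier
  jobs.\<close>

lemma consecutive_jobs_cost_le:
  fixes S p :: "'b \<Rightarrow> real"
  assumes "finite B" "\<And>j. j \<in> B \<Longrightarrow> 0 < p j"
    "\<And>j. j \<in> B \<Longrightarrow> S j \<le> a + sum p {k \<in> B. S k < S j}"
  shows "2 * (\<Sum>j\<in>B. p j * (S j + p j)) \<le> (a + sum p B)\<^sup>2 - a\<^sup>2 + (\<Sum>j\<in>B. (p j)\<^sup>2)"
  using assms
proof (induction B rule: finite_ranking_induct[where f = S])
  case empty
  then show ?case by simp
next
  case (insert j B)
  show ?case
  proof (cases "j \<in> B")
    case True
    then show ?thesis using insert by (simp add: insert_absorb)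
  next
    case False
    have "{k \<in> insert j B. S k < S i} = {k \<in> B. S k < S i}" if "i \<in> insert j B" for i
      using insert.hyps(2)[of i] that by auto
    then have le: "S i \<le> a + sum p {k \<in> B. S k < S i}" if "i \<in> insert j B" for i
      using insert.prems(2)[of i] that by simp
    have "sum p {k \<in> B. S k < S j} \<le> sum p B"
      using insert.prems(1) insert.hyps(1) by (intro sum_mono2) (auto simp: less_imp_le)
    then have "p j * S j \<le> p j * (a + sum p B)"
      using insert.prems(1)[of j] le[of j] by (intro mult_left_mono) auto
    moreover have "2 * (\<Sum>j\<in>B. p j * (S j + p j)) \<le> (a + sum p B)\<^sup>2 - a\<^sup>2 + (\<Sum>j\<in>B. (p j)\<^sup>2)"
      using insert.prems le by (intro insert.IH) auto
    ultimately show ?thesis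
      using False insert.hyps(1) by (simp add: power2_eq_square algebra_simps)
  qed
qed

text \<open>Subadditivity of Lebesgue measure; it turns the absence of idle time into a bound on
  start times.\<close>

lemma covering_bound:
  fixes S p :: "'b \<Rightarrow> real"
  assumes "finite K" "\<And>k. k \<in> K \<Longrightarrow> 0 < p k" "{a..<b} \<subseteq> (\<Union>k\<in>K. {S k..<S k + p k})" "a \<le> b"
  shows "b \<le> a + sum p K"
proof -
  have "ennreal (b - a) = emeasure lborel {a..<b}"
    using assms(4) by simp
  also have "\<dots> \<le> emeasure lborel (\<Union>k\<in>K. {S k..<S k + p k})"
    using assms(1) by (intro emeasure_mono assms(3)) (auto intro!: sets.finite_UN)
  also have "\<dots> \<le> (\<Sum>k\<in>K. emeasure lborel {S k..<S k + p k})"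
    using assms(1) by (intro emeasure_subadditive_finite) auto
  also have "\<dots> = (\<Sum>k\<in>K. ennreal (p k))"
    using assms(2) by (intro sum.cong) (auto simp: less_imp_le)
  also have "\<dots> = ennreal (sum p K)"
    using assms(2) by (intro sum_ennreal) (auto simp: less_imp_le)
  finally show ?thesis
    using assms(2) by (subst (asm) ennreal_le_iff) (auto intro!: sum_nonneg simp: less_imp_le)
qed

section \<open>Costs of schedules in terms of machine loads\<close>

definition feasible_on ::
  "nat \<Rightarrow> (nat \<Rightarrow> real) \<Rightarrow> realization \<Rightarrow> nat set \<Rightarrow> schedule \<Rightarrow> bool" where
  "feasible_on m a x A s \<longleftrightarrow>
     (\<forall>j\<in>A. machine s j < m \<and> a (machine s j) \<le> start s j) \<and>
     (\<forall>j\<in>A. \<forall>k\<in>A. j \<noteq> k \<and> machine s j = machine s k \<longrightarrow>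
        completion x s j \<le> start s k \<or> completion x s k \<le> start s j)"

text \<open>Relative to \<open>A\<close> because it is applied to level sets of the ratio: a machine
  occupied by a job outside \<open>A\<close> counts as idle.\<close>

definition greedy_on ::
  "nat \<Rightarrow> (nat \<Rightarrow> real) \<Rightarrow> realization \<Rightarrow> nat set \<Rightarrow> schedule \<Rightarrow> bool" where
  "greedy_on m a x A s \<longleftrightarrow>
     (\<forall>t. \<forall>i<m. a i \<le> t \<and>
        \<not> (\<exists>k\<in>A. machine s k = i \<and> start s k \<le> t \<and> t < completion x s k) \<longrightarrow>
        (\<forall>j\<in>A. start s j \<le> t))"

definition jobs_on :: "nat set \<Rightarrow> schedule \<Rightarrow> nat \<Rightarrow> nat set" where
  "jobs_on A s i = {j \<in> A. machine s j = i}"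

text \<open>The completion time of the machine when it never idles. A machine without jobs has load
  \<open>a i\<close>, which makes the total load the same in all schedules.\<close>

definition load ::
  "(nat \<Rightarrow> real) \<Rightarrow> realization \<Rightarrow> nat set \<Rightarrow> schedule \<Rightarrow> nat \<Rightarrow> real" where
  "load a x A s i = a i + sum x (jobs_on A s i)"

lemma finite_jobs_on [simp]: "finite A \<Longrightarrow> finite (jobs_on A s i)"
  by (simp add: jobs_on_def)

lemma sum_jobs_on:
  fixes g :: "nat \<Rightarrow> real"
  assumes "feasible_on m a x A s" "finite A"
  shows "(\<Sum>i<m. sum g (jobs_on A s i)) = sum g A"
  unfolding jobs_on_def
  using assms by (intro sum.group) (auto simp: feasible_on_def)

lemma sum_load:
  assumes "feasible_on m a x A s" "finite A"
  shows "(\<Sum>i<m. load a x A s i) = sum a {..<m} + sum x A"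
  using sum_jobs_on[OF assms, of x] by (simp add: load_def sum.distrib)

lemma feasible_cost_ge:
  assumes "feasible_on m a x A s" "finite A" "\<And>j. j \<in> A \<Longrightarrow> 0 < x j"
  shows "(\<Sum>i<m. (load a x A s i)\<^sup>2 - (a i)\<^sup>2) + (\<Sum>j\<in>A. (x j)\<^sup>2)
    \<le> 2 * (\<Sum>j\<in>A. x j * completion x s j)"
proof -
  have "(\<Sum>i<m. (load a x A s i)\<^sup>2 - (a i)\<^sup>2 + (\<Sum>j\<in>jobs_on A s i. (x j)\<^sup>2))
      \<le> (\<Sum>i<m. 2 * (\<Sum>j\<in>jobs_on A s i. x j * completion x s j))"
    unfolding load_def completion_def
    using assms by (intro sum_mono disjoint_jobs_cost_ge)
      (auto simp: feasible_on_def jobs_on_def completion_def)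
  then show ?thesis
    using sum_jobs_on[OF assms(1,2), of "\<lambda>j. (x j)\<^sup>2"]
      sum_jobs_on[OF assms(1,2), of "\<lambda>j. x j * completion x s j"]
    by (simp add: sum.distrib flip: sum_distrib_left)
qed

text \<open>An idle moment of machine \<open>i\<close> in \<open>{a i..<start s j}\<close> would
  force \<open>j\<close> to have started already, so jobs of this machine that start before
  \<open>j\<close> cover the interval.\<close>

lemma greedy_start_le:
  assumes "greedy_on m a x A s" "feasible_on m a x A s" "finite A" "\<And>j. j \<in> A \<Longrightarrow> 0 < x j"
    and "j \<in> jobs_on A s i"
  shows "start s j \<le> a i + sum x {k \<in> jobs_on A s i. start s k < start s j}"
proof (rule covering_bound)
  show "a i \<le> start s j"
    using assms(2,5) by (auto simp: feasible_on_def jobs_on_def)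
  have "i < m" "j \<in> A"
    using assms(2,5) by (auto simp: feasible_on_def jobs_on_def)
  then show "{a i..<start s j} \<subseteq>
      (\<Union>k\<in>{k \<in> jobs_on A s i. start s k < start s j}. {start s k..<start s k + x k})"
    using assms(1) unfolding greedy_on_def jobs_on_def completion_def
    by (fastforce simp: not_le[symmetric])
qed (use assms in \<open>auto simp: jobs_on_def\<close>)

lemma greedy_cost_le:
  assumes "greedy_on m a x A s" "feasible_on m a x A s" "finite A" "\<And>j. j \<in> A \<Longrightarrow> 0 < x j"
  shows "2 * (\<Sum>j\<in>A. x j * completion x s j)
    \<le> (\<Sum>i<m. (load a x A s i)\<^sup>2 - (a i)\<^sup>2) + (\<Sum>j\<in>A. (x j)\<^sup>2)"
proof -
  have "(\<Sum>i<m. 2 * (\<Sum>j\<in>jobs_on A s i. x j * completion x s j))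
      \<le> (\<Sum>i<m. (load a x A s i)\<^sup>2 - (a i)\<^sup>2 + (\<Sum>j\<in>jobs_on A s i. (x j)\<^sup>2))"
    unfolding load_def completion_def
    using assms greedy_start_le[OF assms] by (intro sum_mono consecutive_jobs_cost_le)
      (auto simp: jobs_on_def)
  then show ?thesis
    using sum_jobs_on[OF assms(2,3), of "\<lambda>j. (x j)\<^sup>2"]
      sum_jobs_on[OF assms(2,3), of "\<lambda>j. x j * completion x s j"]
    by (simp add: sum.distrib flip: sum_distrib_left)
qed

text \<open>At time \<open>load a x A s i\<close> machine \<open>i\<close> has completed all its
  jobs, so greediness forces every job, on whichever machine, to have started.\<close>

lemma greedy_start_le_load:
  assumes "greedy_on m a x A s" "feasible_on m a x A s" "finite A" "\<And>j. j \<in> A \<Longrightarrow> 0 < x j"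
    and "i < m" "j \<in> A"
  shows "start s j \<le> load a x A s i"
proof -
  have "completion x s k \<le> load a x A s i" if k: "k \<in> jobs_on A s i" for k
  proof -
    have "x k + sum x {l \<in> jobs_on A s i. start s l < start s k}
        = sum x (insert k {l \<in> jobs_on A s i. start s l < start s k})"
      using assms(3) by (subst sum.insert) auto
    also have "\<dots> \<le> sum x (jobs_on A s i)"
      using assms(3) k assms(4)
      by (intro sum_mono2) (auto simp: jobs_on_def less_imp_le)
    finally show ?thesis
      using greedy_start_le[OF assms(1-4) k] by (simp add: load_def completion_def)
  qed
  moreover have "a i \<le> load a x A s i"
    using assms(4) sum_nonneg[of "jobs_on A s i" x]
    by (force simp: load_def jobs_on_def less_imp_le)
  ultimately show ?thesis
    using assms(1,5,6) unfolding greedy_on_def jobs_on_def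
    by (metis (mono_tags, lifting) mem_Collect_eq not_less)
qed

text \<open>For the job that starts last, \<open>packing_bound\<close> and
  \<open>greedy_start_le\<close> bound its start from below and from above by the arrival time plus
  the lengths of the other jobs.\<close>

lemma greedy_last_job:
  assumes "greedy_on m a x A s" "feasible_on m a x A s" "finite A" "\<And>j. j \<in> A \<Longrightarrow> 0 < x j"
    and "jobs_on A s i \<noteq> {}"
  obtains j where "j \<in> jobs_on A s i" "load a x A s i = start s j + x j"
proof -
  have fin: "finite (start s ` jobs_on A s i)" "start s ` jobs_on A s i \<noteq> {}"
    using assms(3,5) by auto
  obtain j where j: "j \<in> jobs_on A s i" "start s j = Max (start s ` jobs_on A s i)"
    using Max_in[OF fin] by auto
  have le: "start s k \<le> start s j" if "k \<in> jobs_on A s i" for k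
    using fin that j(2) by simp
  have "a i + sum x (jobs_on A s i - {j}) \<le> start s j"
  proof (rule packing_bound[where S = "start s"])
    show "start s k + x k \<le> start s j" if "k \<in> jobs_on A s i - {j}" for k
    proof -
      have "0 < x j" "completion x s k \<le> start s j \<or> completion x s j \<le> start s k"
        using assms(2,4) that j(1) by (auto simp: feasible_on_def jobs_on_def)
      then show ?thesis
        using le[of k] that by (auto simp: completion_def)
    qed
  qed (use assms(2-4) j(1) in \<open>auto simp: feasible_on_def jobs_on_def completion_def\<close>)
  moreover have "sum x {k \<in> jobs_on A s i. start s k < start s j} \<le> sum x (jobs_on A s i - {j})"
    using assms(3,4) by (intro sum_mono2) (auto simp: jobs_on_def less_imp_le)
  moreover have "sum x (jobs_on A s i) = x j + sum x (jobs_on A s i - {j})"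
    using assms(3) j(1) by (intro sum.remove) auto
  ultimately show ?thesis
    using that[OF j(1)] greedy_start_le[OF assms(1-4) j(1)] by (simp add: load_def)
qed

subsection \<open>The Kawaguchi--Kyan bound with machine arrivals\<close>

text \<open>This is \<open>1 + (sqrt 2 - 1) / 2\<close>, the guarantee for
  \<open>\<Delta> = 0\<close>.\<close>

definition kk :: real where "kk = (1 + sqrt 2) / 2"

text \<open>The threshold is subtracted twice on the left but only once on the right.\<close>

lemma pos_part_square_add_le:
  fixes u v \<tau> :: real
  assumes "0 \<le> u" "0 \<le> v" "0 \<le> \<tau>"
  shows "(max 0 (u - \<tau>))\<^sup>2 + (max 0 (v - \<tau>))\<^sup>2 \<le> (max 0 (u + v - \<tau>))\<^sup>2"
proof -
  have "(max 0 (u - \<tau>))\<^sup>2 + (max 0 (v - \<tau>))\<^sup>2 \<le> (max 0 (u - \<tau>) + max 0 (v - \<tau>))\<^sup>2"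
    by (simp add: power2_sum)
  also have "\<dots> \<le> (max 0 (u + v - \<tau>))\<^sup>2"
    using assms by (intro power_mono) (auto simp: max_def)
  finally show ?thesis .
qed

lemma sum_pos_part_square_le:
  fixes x :: "'b \<Rightarrow> real"
  assumes "finite B" "\<And>j. j \<in> B \<Longrightarrow> 0 \<le> x j" "0 \<le> \<tau>"
  shows "(\<Sum>j\<in>B. (max 0 (x j - \<tau>))\<^sup>2) \<le> (max 0 (sum x B - \<tau>))\<^sup>2"
  using assms
proof (induction B)
  case empty
  then show ?case by simp
next
  case (insert j B)
  have "(max 0 (x j - \<tau>))\<^sup>2 + (max 0 (sum x B - \<tau>))\<^sup>2 \<le> (max 0 (x j + sum x B - \<tau>))\<^sup>2"
    using insert.prems by (intro pos_part_square_add_le sum_nonneg) auto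
  then show ?case using insert by fastforce
qed

text \<open>The tangent of the square at \<tau>, improved by the squared excess over \<tau>. For
  \<open>\<tau> \<le> L\<close> this is an equality, so a machine with a very long job loses
  nothing.\<close>

lemma square_ge_tangent:
  fixes L \<tau> :: real
  shows "2 * \<tau> * L - \<tau>\<^sup>2 + (max 0 (L - \<tau>))\<^sup>2 \<le> L\<^sup>2"
proof (cases "\<tau> \<le> L")
  case True
  then show ?thesis by (simp add: power2_eq_square algebra_simps)
next
  case False
  then show ?thesis using zero_le_power2[of "L - \<tau>"] by (simp add: power2_diff mult.commute mult.left_commute)
qed

text \<open>
  Here \<open>l\<close> is the minimum load, \<open>p\<close> the last job of the machine and \<open>s\<close> its start.  The summand
  \<open>(kk - 1) * s\<close> stands for the squares of the earlier jobs, which have integral lengths; it pays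
  for the arrival time \<open>b\<close>.
\<close>

lemma machine_inequality:
  fixes l s p b :: real
  assumes l: "2 \<le> l" and s: "0 \<le> s" "s \<le> l" "l \<le> s + p" and b: "b = 0 \<or> b = 1 \<and> (s = 1 \<or> 2 \<le> s)"
  shows "(s + p)\<^sup>2 + (kk - 1) * (b + b\<^sup>2) \<le> kk * (2 * (sqrt 2 * l) * (s + p) - (sqrt 2 * l)\<^sup>2
     + (max 0 (p - sqrt 2 * l))\<^sup>2) + (kk - 1) * (p\<^sup>2 + s)"
proof -
  define d where "d = sqrt 2"
  have d2: "d * d = 2" and d1: "1 < d" "d < 3"
    by (auto simp: d_def real_less_lsqrt)
  have k: "2 * kk = 1 + d" "kk > 1" "kk < 2"
    using d1 by (auto simp: kk_def d_def)
  \<comment> \<open>\<open>f\<close> is the slack of the claim without the arrival terms and without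
    \<open>(kk - 1) * s\<close>.\<close>
  define f where "f = kk * (2 * (d * l) * (s + p) - (d * l)\<^sup>2 + (max 0 (p - d * l))\<^sup>2)
     + (kk - 1) * p\<^sup>2 - (s + p)\<^sup>2"
  \<comment> \<open>For \<open>b = 1\<close> the summand \<open>(kk - 1) * s\<close> has to pay
    \<open>2 * (kk - 1)\<close>. It suffices when \<open>2 \<le> s\<close>; when
    \<open>s = 1\<close> the slack supplies the other half.\<close>
  have f: "0 \<le> f \<and> (s = 1 \<longrightarrow> kk - 1 \<le> f)"
  proof (cases "d * l \<le> p")
    case True
    \<comment> \<open>Completing the square in \<open>p\<close>, using
      \<open>(d - 1) * (d + 1) = 1\<close>. The slack vanishes for \<open>s = l\<close> and
      \<open>p = (1 + sqrt 2) * l\<close>.\<close>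
    have "2 * f = 2 * ((d - 1) * (p - (1 + d) * s)\<^sup>2 + (2 + d) * (s * (l - s)))"
    proof -
      have "2 * f = (1 + d) * (2 * (d * l) * (s + p) - (d * l)\<^sup>2 + (p - d * l)\<^sup>2)
         + (d - 1) * p\<^sup>2 - 2 * (s + p)\<^sup>2"
        using True k(1) by (simp add: f_def kk_def d_def field_simps)
      then show ?thesis using d2 by algebra
    qed
    then have eq: "f = (d - 1) * (p - (1 + d) * s)\<^sup>2 + (2 + d) * (s * (l - s))"
      by simp
    have "0 \<le> (d - 1) * (p - (1 + d) * s)\<^sup>2" "0 \<le> (2 + d) * (s * (l - s))"
      using d1 s by (auto intro!: mult_nonneg_nonneg)
    moreover have "1 \<le> (2 + d) * (s * (l - s))" if "s = 1"
      using that l d1 mult_mono[of 1 "2 + d" 1 "l - 1"] by simp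
    ultimately show ?thesis using k eq by (smt (verit))
  next
    case False
    \<comment> \<open>The excess of this load over the minimum load. From \<open>s \<le> l\<close>
      follows \<open>e \<le> p < d * l\<close>, so both summands of \<open>f\<close> are
      nonnegative.\<close>
    define e where "e = s + p - l"
    have "2 * f = 2 * (e * (d * l - e) + (kk - 1) * p\<^sup>2)"
    proof -
      have "2 * f = (1 + d) * (2 * (d * l) * (s + p) - (d * l)\<^sup>2)
         + (d - 1) * p\<^sup>2 - 2 * (s + p)\<^sup>2"
        using False k(1) by (simp add: f_def kk_def d_def field_simps)
      moreover have "2 * (e * (d * l - e) + (kk - 1) * p\<^sup>2) = 2 * (e * (d * l - e)) + (d - 1) * p\<^sup>2"
        by (simp add: kk_def d_def field_simps)
      ultimately show ?thesis using d2 e_def by algebra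
    qed
    then have eq: "f = e * (d * l - e) + (kk - 1) * p\<^sup>2"
      by simp
    have "0 \<le> e * (d * l - e)" "0 \<le> (kk - 1) * p\<^sup>2"
      using s False k by (auto simp: e_def intro!: mult_nonneg_nonneg)
    moreover have "kk - 1 \<le> (kk - 1) * p\<^sup>2" if "s = 1"
      using that s l k by (simp add: power2_eq_square mult_ge1_I)
    ultimately show ?thesis using eq by auto
  qed
  have "(kk - 1) * (b + b\<^sup>2) \<le> f + (kk - 1) * s"
    using b
  proof (elim disjE conjE)
    assume "b = 1" "2 \<le> s"
    then show ?thesis using f k mult_left_mono[of 2 s "kk - 1"] by simp
  qed (use f k s in \<open>auto intro!: mult_nonneg_nonneg add_nonneg_nonneg\<close>)
  then show ?thesis by (simp add: f_def d_def algebra_simps)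
qed

lemma integer_load:
  assumes "\<And>j. j \<in> A \<Longrightarrow> x j \<in> \<int>" "a i \<in> {0, 1}"
  shows "load a x A s i \<in> \<int>"
  using assms by (auto simp: load_def jobs_on_def intro!: Ints_add Ints_sum)

text \<open>\<open>machine_inequality\<close> for the last job of the machine. The earlier jobs have
  lengths at least 1, so the sum of their squares is at least that of their lengths, which is
  \<open>start s j - a i\<close>. The lost \<open>a i\<close> is why \<open>b\<close> appears
  linearly in \<open>machine_inequality\<close>.\<close>

lemma greedy_machine_bound:
  assumes greedy: "greedy_on m a x A s" "feasible_on m a x A s" "finite A"
    and pos: "\<And>j. j \<in> A \<Longrightarrow> 0 < x j" and int: "\<And>j. j \<in> A \<Longrightarrow> x j \<in> \<int>"
    and a: "a i \<in> {0, 1}" and l: "2 \<le> l" "l \<le> load a x A s i" "\<And>j. j \<in> A \<Longrightarrow> start s j \<le> l"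
  shows "(load a x A s i)\<^sup>2 + (kk - 1) * (a i)\<^sup>2
    \<le> kk * (2 * (sqrt 2 * l) * load a x A s i - (sqrt 2 * l)\<^sup>2
        + (\<Sum>j\<in>jobs_on A s i. (max 0 (x j - sqrt 2 * l))\<^sup>2))
      + (kk - 1) * (\<Sum>j\<in>jobs_on A s i. (x j)\<^sup>2)"
proof -
  let ?B = "jobs_on A s i"
  have ge1: "1 \<le> x j" if "j \<in> A" for j
    using pos[OF that] int[OF that] by (auto simp: Ints_def)
  have "?B \<noteq> {}"
    using l a by (auto simp: load_def)
  then obtain j where j: "j \<in> ?B" and Lj: "load a x A s i = start s j + x j"
    using greedy_last_job[OF greedy pos] by blast
  then have jA: "j \<in> A" "a i \<le> start s j"
    using greedy(2) by (auto simp: jobs_on_def feasible_on_def)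
  have "start s j = load a x A s i - x j"
    using Lj by simp
  then have "start s j \<in> \<int>"
    using integer_load[of A x a i s] int a jA(1) by auto
  then have b: "a i = 0 \<or> a i = 1 \<and> (start s j = 1 \<or> 2 \<le> start s j)"
    using a jA(2) by (auto simp: Ints_def)
  have fin: "finite ?B"
    using greedy(3) by simp
  have rem: "sum g ?B = g j + sum g (?B - {j})" for g :: "nat \<Rightarrow> real"
    using fin j by (intro sum.remove) auto
  have "sum x (?B - {j}) \<le> (\<Sum>j\<in>?B - {j}. (x j)\<^sup>2)"
    using ge1 by (intro sum_mono self_le_power) (auto simp: jobs_on_def)
  moreover have "sum x (?B - {j}) = start s j - a i"
    using Lj rem[of x] by (simp add: load_def)
  ultimately have sq: "(x j)\<^sup>2 + start s j - a i \<le> (\<Sum>j\<in>?B. (x j)\<^sup>2)"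
    using rem[of "\<lambda>j. (x j)\<^sup>2"] by simp
  have ex: "(max 0 (x j - sqrt 2 * l))\<^sup>2 \<le> (\<Sum>j\<in>?B. (max 0 (x j - sqrt 2 * l))\<^sup>2)"
    using fin j by (intro member_le_sum) auto
  have kk: "1 < kk" by (simp add: kk_def)
  have "(start s j + x j)\<^sup>2 + (kk - 1) * (a i + (a i)\<^sup>2)
      \<le> kk * (2 * (sqrt 2 * l) * (start s j + x j) - (sqrt 2 * l)\<^sup>2 + (max 0 (x j - sqrt 2 * l))\<^sup>2)
        + (kk - 1) * ((x j)\<^sup>2 + start s j)"
    using a jA l Lj by (intro machine_inequality l(1) b) auto
  moreover have "kk * (max 0 (x j - sqrt 2 * l))\<^sup>2 \<le> kk * (\<Sum>j\<in>?B. (max 0 (x j - sqrt 2 * l))\<^sup>2)"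
    using kk ex by (intro mult_left_mono) auto
  moreover have "(kk - 1) * ((x j)\<^sup>2 + start s j - a i) \<le> (kk - 1) * (\<Sum>j\<in>?B. (x j)\<^sup>2)"
    using kk sq by (intro mult_left_mono) auto
  ultimately show ?thesis
    by (simp add: Lj algebra_simps)
qed

text \<open>The parameter \<open>\<tau>\<close> is a Lagrange multiplier for the conservation of the total load.\<close>

lemma load_squares_ge:
  assumes "feasible_on m a x A s" "finite A" "\<And>j. j \<in> A \<Longrightarrow> 0 < x j"
    and "\<And>i. i < m \<Longrightarrow> 0 \<le> a i" "0 \<le> \<tau>"
  shows "(\<Sum>i<m. 2 * \<tau> * load a x A s i - \<tau>\<^sup>2) + (\<Sum>j\<in>A. (max 0 (x j - \<tau>))\<^sup>2)
    \<le> (\<Sum>i<m. (load a x A s i)\<^sup>2)"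
proof -
  have "(\<Sum>j\<in>jobs_on A s i. (max 0 (x j - \<tau>))\<^sup>2) \<le> (max 0 (load a x A s i - \<tau>))\<^sup>2" if "i < m" for i
  proof -
    have "(\<Sum>j\<in>jobs_on A s i. (max 0 (x j - \<tau>))\<^sup>2) \<le> (max 0 (sum x (jobs_on A s i) - \<tau>))\<^sup>2"
      using assms by (intro sum_pos_part_square_le) (auto simp: jobs_on_def less_imp_le)
    also have "\<dots> \<le> (max 0 (load a x A s i - \<tau>))\<^sup>2"
      using assms(4)[OF that] by (intro power_mono) (auto simp: load_def)
    finally show ?thesis .
  qed
  then have "(\<Sum>i<m. 2 * \<tau> * load a x A s i - \<tau>\<^sup>2 + (\<Sum>j\<in>jobs_on A s i. (max 0 (x j - \<tau>))\<^sup>2))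
      \<le> (\<Sum>i<m. (load a x A s i)\<^sup>2)"
    using square_ge_tangent[of \<tau>]
    by (intro sum_mono order_trans[OF add_left_mono square_ge_tangent]) auto
  then show ?thesis
    using sum_jobs_on[OF assms(1,2), of "\<lambda>j. (max 0 (x j - \<tau>))\<^sup>2"] by (simp add: sum.distrib)
qed

text \<open>\<open>T\<close> depends on the loads only through their total and \<open>E\<close> only
  on the jobs, so \<open>T + E\<close> can be bounded above by the loads of \<open>s'\<close> and
  used for those of \<open>s\<close>. The term \<open>(kk - 1) * a2\<close> compensates for
  \<open>- a2\<close> being multiplied by \<open>kk\<close> on the side of \<open>s'\<close>
  only.\<close>

lemma unit_ratio_bound_large:
  assumes greedy: "greedy_on m a x A s" "feasible_on m a x A s" "finite A"
    and pos: "\<And>j. j \<in> A \<Longrightarrow> 0 < x j" and int: "\<And>j. j \<in> A \<Longrightarrow> x j \<in> \<int>"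
    and a: "\<And>i. i < m \<Longrightarrow> a i \<in> {0, 1}" and opt: "feasible_on m a x A s'"
    and l: "2 \<le> l" "\<And>i. i < m \<Longrightarrow> l \<le> load a x A s i" "\<And>j. j \<in> A \<Longrightarrow> start s j \<le> l"
  shows "(\<Sum>j\<in>A. x j * completion x s j) \<le> kk * (\<Sum>j\<in>A. x j * completion x s' j)"
proof -
  define \<tau> where "\<tau> = sqrt 2 * l"
  have \<tau>: "0 \<le> \<tau>" using l by (simp add: \<tau>_def)
  have kk: "1 < kk" by (simp add: kk_def)
  define D where "D = (\<Sum>j\<in>A. (x j)\<^sup>2)"
  define E where "E = (\<Sum>j\<in>A. (max 0 (x j - \<tau>))\<^sup>2)"
  define T where "T = (\<Sum>i<m. 2 * \<tau> * load a x A s i - \<tau>\<^sup>2)"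
  define LS LO where "LS = (\<Sum>i<m. (load a x A s i)\<^sup>2)" and "LO = (\<Sum>i<m. (load a x A s' i)\<^sup>2)"
  define a2 where "a2 = (\<Sum>i<m. (a i)\<^sup>2)"
  have "(\<Sum>i<m. (load a x A s i)\<^sup>2 + (kk - 1) * (a i)\<^sup>2)
    \<le> (\<Sum>i<m. kk * (2 * \<tau> * load a x A s i - \<tau>\<^sup>2 + (\<Sum>j\<in>jobs_on A s i. (max 0 (x j - \<tau>))\<^sup>2))
      + (kk - 1) * (\<Sum>j\<in>jobs_on A s i. (x j)\<^sup>2))"
    unfolding \<tau>_def using l a by (intro sum_mono greedy_machine_bound[OF greedy pos int]) auto
  then have "LS + (kk - 1) * a2 \<le> kk * (T + E) + (kk - 1) * D"
    unfolding LS_def a2_def T_def E_def D_def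
    using sum_jobs_on[OF greedy(2,3), of "\<lambda>j. (max 0 (x j - \<tau>))\<^sup>2"]
      sum_jobs_on[OF greedy(2,3), of "\<lambda>j. (x j)\<^sup>2"]
    by (simp add: sum.distrib flip: sum_distrib_left)
  moreover have "T = 2 * \<tau> * (\<Sum>i<m. load a x A s i) - m * \<tau>\<^sup>2"
    by (simp add: T_def sum_subtractf sum_distrib_left)
  then have "T + E \<le> LO"
    using load_squares_ge[OF opt greedy(3) pos _ \<tau>] a sum_load[OF greedy(2,3)] sum_load[OF opt greedy(3)]
    by (force simp: E_def LO_def sum_subtractf simp flip: sum_distrib_left)
  then have "kk * (T + E) \<le> kk * LO"
    using kk by (intro mult_left_mono) auto
  moreover have "2 * (\<Sum>j\<in>A. x j * completion x s j) \<le> LS - a2 + D"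
    using greedy_cost_le[OF greedy pos] by (simp add: LS_def a2_def D_def sum_subtractf)
  moreover have "LO - a2 + D \<le> 2 * (\<Sum>j\<in>A. x j * completion x s' j)"
    using feasible_cost_ge[OF opt greedy(3) pos] by (simp add: LO_def a2_def D_def sum_subtractf)
  then have "kk * (LO - a2 + D) \<le> kk * (2 * (\<Sum>j\<in>A. x j * completion x s' j))"
    using kk by (intro mult_left_mono) auto
  ultimately show ?thesis
    by (simp add: algebra_simps)
qed

text \<open>
  The greedy schedule starts at least as many jobs at \<open>0\<close> (the set \<open>J\<close>) as any other schedule can
  start before \<open>1\<close> (the set \<open>H\<close>), so only the choice of these jobs can be suboptimal.
\<close>

lemma unit_ratio_bound_small:
  assumes greedy: "greedy_on m a x A s" "feasible_on m a x A s" "finite A"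
    and pos: "\<And>j. j \<in> A \<Longrightarrow> 0 < x j" and int: "\<And>j. j \<in> A \<Longrightarrow> x j \<in> \<int>"
    and a: "\<And>i. i < m \<Longrightarrow> a i \<in> {0, 1}" and opt: "feasible_on m a x A s'"
    and l: "\<And>i. i < m \<Longrightarrow> 1 \<le> load a x A s i" "\<And>j. j \<in> A \<Longrightarrow> start s j \<le> 1"
  shows "(\<Sum>j\<in>A. x j * completion x s j) \<le> kk * (\<Sum>j\<in>A. x j * completion x s' j)"
proof -
  define I where "I = {i. i < m \<and> a i = 0}"
  define H where "H = {j \<in> A. start s' j < 1}"
  define J where "J = {j \<in> A. start s j \<le> 0}"
  have fin: "finite A" "finite H" "finite J" "finite I"
    using greedy(3) by (auto simp: H_def J_def I_def)
  have ge1: "1 \<le> x j" if "j \<in> A" for j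
    using pos[OF that] int[OF that] by (auto simp: Ints_def)
  have "0 \<le> start s' j" if "j \<in> A" for j
    using opt a that by (fastforce simp: feasible_on_def)
  \<comment> \<open>Lengths are at least 1, so no machine can start two jobs before time 1.\<close>
  have "inj_on (machine s') H"
  proof (rule inj_onI, rule ccontr)
    fix j k assume jk: "j \<in> H" "k \<in> H" "machine s' j = machine s' k" "j \<noteq> k"
    then have "completion x s' j \<le> start s' k \<or> completion x s' k \<le> start s' j"
      using opt by (auto simp: feasible_on_def H_def)
    moreover have "0 \<le> start s' j" "0 \<le> start s' k" "1 \<le> x j" "1 \<le> x k"
      using \<open>\<And>j. j \<in> A \<Longrightarrow> 0 \<le> start s' j\<close> ge1 jk by (auto simp: H_def)
    ultimately show False
      using jk by (auto simp: H_def completion_def)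
  qed
  moreover have "machine s' ` H \<subseteq> I"
    using opt a by (fastforce simp: feasible_on_def H_def I_def)
  ultimately have "card H \<le> card I"
    using fin by (intro card_inj_on_le)
  \<comment> \<open>A machine of \<open>I\<close> has load at least 1, hence a job, and its first
    job starts without delay.\<close>
  also have "I \<subseteq> machine s ` J"
  proof
    fix i assume i: "i \<in> I"
    have "jobs_on A s i \<noteq> {}"
      using l(1)[of i] i by (auto simp: load_def I_def)
    then have ne: "finite (start s ` jobs_on A s i)" "start s ` jobs_on A s i \<noteq> {}"
      using fin by auto
    obtain j where j: "j \<in> jobs_on A s i" "start s j = Min (start s ` jobs_on A s i)"
      using Min_in[OF ne] by auto
    have none: "{k \<in> jobs_on A s i. start s k < start s j} = {}"
      using ne j(2) by (auto simp: not_less)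
    have "start s j \<le> a i + sum x {k \<in> jobs_on A s i. start s k < start s j}"
      using pos by (intro greedy_start_le[OF greedy _ j(1)])
    then have "start s j \<le> 0"
      using i unfolding none by (simp add: I_def)
    then show "i \<in> machine s ` J"
      using j(1) by (auto simp: J_def jobs_on_def)
  qed
  then have "card I \<le> card J"
    using fin by (meson card_image_le card_mono finite_imageI order_trans)
  finally have "card H \<le> card J" .
  then have card: "card (H - J) \<le> card (J - H)"
    using fin by (simp add: card_Diff_subset_Int Int_commute)
  have sp: "sum g A = sum g H + sum g (A - H)" "sum g A = sum g J + sum g (A - J)"
    "sum g H = sum g (H \<inter> J) + sum g (H - J)" "sum g J = sum g (H \<inter> J) + sum g (J - H)"
    for g :: "nat \<Rightarrow> real"
  proof -
    show "sum g A = sum g H + sum g (A - H)" "sum g A = sum g J + sum g (A - J)"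
      using sum.subset_diff[of H A g] sum.subset_diff[of J A g] fin(1)
      by (auto simp: H_def J_def add.commute)
    show "sum g H = sum g (H \<inter> J) + sum g (H - J)"
      using fin(2) by (rule sum.Int_Diff)
    show "sum g J = sum g (H \<inter> J) + sum g (J - H)"
      using fin(3) sum.Int_Diff[of J g H] by (simp add: Int_commute)
  qed
  define D where "D = (\<Sum>j\<in>A. (x j)\<^sup>2)"
  have "(\<Sum>j\<in>A. x j * start s j) \<le> (\<Sum>j\<in>A. if j \<in> J then 0 else x j)"
  proof (rule sum_mono)
    fix j assume j: "j \<in> A"
    show "x j * start s j \<le> (if j \<in> J then 0 else x j)"
      using mult_left_mono[of "start s j" 0 "x j"] mult_left_mono[of "start s j" 1 "x j"] pos[OF j] l(2)[OF j] j
      by (auto simp: J_def)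
  qed
  also have "\<dots> = sum x (A - J)"
    using fin(1) by (simp add: sum.If_cases Diff_eq)
  finally have S: "(\<Sum>j\<in>A. x j * completion x s j) \<le> D + sum x (A - J)"
    by (simp add: D_def completion_def distrib_left sum.distrib power2_eq_square)
  have "sum x (A - H) = (\<Sum>j\<in>A. if j \<in> H then 0 else x j)"
    using fin(1) by (simp add: sum.If_cases Diff_eq)
  also have "\<dots> \<le> (\<Sum>j\<in>A. x j * start s' j)"
  proof (rule sum_mono)
    fix j assume j: "j \<in> A"
    show "(if j \<in> H then 0 else x j) \<le> x j * start s' j"
      using mult_left_mono[of 1 "start s' j" "x j"] pos[OF j] \<open>\<And>j. j \<in> A \<Longrightarrow> 0 \<le> start s' j\<close>[OF j] j
      by (auto simp: H_def)
  qed
  finally have O: "D + sum x (A - H) \<le> (\<Sum>j\<in>A. x j * completion x s' j)"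
    by (simp add: D_def completion_def distrib_left sum.distrib power2_eq_square)
  have cJ: "card (J - H) \<le> sum x (J - H)" "card (J - H) \<le> (\<Sum>j\<in>J - H. (x j)\<^sup>2)"
    using ge1 sum_bounded_below[of "J - H" 1 x] sum_bounded_below[of "J - H" 1 "\<lambda>j. (x j)\<^sup>2"]
    by (auto simp: J_def)
  have "sum x (A - J) - sum x (A - H) = sum x (H - J) - sum x (J - H)"
    using sp[of x] by simp
  also have "\<dots> \<le> sum x (H - J) - card (H - J)"
    using cJ card by simp
  also have "\<dots> = (\<Sum>j\<in>H - J. x j - 1)"
    by (simp add: sum_subtractf)
  \<comment> \<open>Each job of \<open>H - J\<close> is matched by one of \<open>J - H\<close>,
    which contributes at least 1 to the squares and at least 1 to \<open>sum x (A - H)\<close>; this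
    is the summand 2. The difference of the two sides is a positive quadratic with minimum at
    \<open>x j = 1 + sqrt 2\<close>.\<close>
  also have "\<dots> \<le> (\<Sum>j\<in>H - J. (kk - 1) * ((x j)\<^sup>2 + 2))"
  proof (rule sum_mono)
    fix j
    define d where "d = sqrt 2"
    have d: "d * d = 2" "1 < d" by (auto simp: d_def)
    have "d \<le> 3 / 2"
      unfolding d_def by (rule real_le_lsqrt) (auto simp: power2_eq_square)
    have "2 * ((kk - 1) * ((x j)\<^sup>2 + 2) - (x j - 1)) = (d - 1) * ((x j)\<^sup>2 + 2) - 2 * (x j - 1)"
      by (simp add: kk_def d_def field_simps)
    also have "\<dots> = (d - 1) * (x j - (1 + d))\<^sup>2 + (d - 1)"
    proof -
      have "(d - 1) * (x j - (1 + d))\<^sup>2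
          = (d - 1) * (x j)\<^sup>2 - 2 * x j * (d * d - 1) + (d * d - 1) * (1 + d)"
        by (simp add: power2_eq_square algebra_simps)
      then show ?thesis
        unfolding d(1) by (simp add: algebra_simps)
    qed
    also have "\<dots> \<ge> 0"
      using d by auto
    finally show "x j - 1 \<le> (kk - 1) * ((x j)\<^sup>2 + 2)"
      by simp
  qed
  also have "\<dots> = (kk - 1) * ((\<Sum>j\<in>H - J. (x j)\<^sup>2) + 2 * card (H - J))"
    by (simp add: sum.distrib mult.commute flip: sum_distrib_left)
  also have "\<dots> \<le> (kk - 1) * (\<Sum>j\<in>A. x j * completion x s' j)"
  proof (rule mult_left_mono)
    have "(\<Sum>j\<in>H - J. (x j)\<^sup>2) + (\<Sum>j\<in>J - H. (x j)\<^sup>2) = (\<Sum>j\<in>(H - J) \<union> (J - H). (x j)\<^sup>2)"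
      using fin by (subst sum.union_disjoint) auto
    also have "\<dots> \<le> D"
      unfolding D_def using fin(1) by (intro sum_mono2) (auto simp: H_def J_def)
    finally have 1: "(\<Sum>j\<in>H - J. (x j)\<^sup>2) + (\<Sum>j\<in>J - H. (x j)\<^sup>2) \<le> D" .
    have "sum x (J - H) \<le> sum x (A - H)"
      using fin(1) pos by (intro sum_mono2) (auto simp: J_def less_imp_le)
    with 1 show "(\<Sum>j\<in>H - J. (x j)\<^sup>2) + 2 * card (H - J) \<le> (\<Sum>j\<in>A. x j * completion x s' j)"
      using O cJ card by simp
  qed (simp add: kk_def)
  finally show ?thesis
    using S O by (simp add: algebra_simps)
qed

lemma unit_ratio_bound:
  assumes greedy: "greedy_on m a x A s" "feasible_on m a x A s" "finite A"
    and pos: "\<And>j. j \<in> A \<Longrightarrow> 0 < x j" and int: "\<And>j. j \<in> A \<Longrightarrow> x j \<in> \<int>"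
    and a: "\<And>i. i < m \<Longrightarrow> a i \<in> {0, 1}" and opt: "feasible_on m a x A s'"
  shows "(\<Sum>j\<in>A. x j * completion x s j) \<le> kk * (\<Sum>j\<in>A. x j * completion x s' j)"
proof (cases "A = {}")
  case True
  then show ?thesis by simp
next
  case False
  then have m: "0 < m"
    using greedy(2) by (auto simp: feasible_on_def)
  define l where "l = Min (load a x A s ` {..<m})"
  have fin: "finite (load a x A s ` {..<m})" "load a x A s ` {..<m} \<noteq> {}"
    using m by auto
  obtain i where i: "i < m" "l = load a x A s i"
    using Min_in[OF fin] by (auto simp: l_def)
  have load: "l \<le> load a x A s i" if "i < m" for i
    using that fin by (auto simp: l_def)
  have start: "start s j \<le> l" if "j \<in> A" for j
    using greedy_start_le_load[OF greedy pos i(1) that] i(2) by simp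
  have "l \<in> \<int>"
    unfolding i(2) by (rule integer_load[where A = A]) (use int a i(1) in auto)
  then consider "l \<le> 0" | "l = 1" | "2 \<le> l"
    by (force simp: Ints_def)
  then show ?thesis
  proof cases
    case 1
    \<comment> \<open>Greedy starts are at most 0 and all others at least 0, so greedy is optimal
      job by job.\<close>
    have 0: "0 \<le> start s' j" if "j \<in> A" for j
      using opt a that by (fastforce simp: feasible_on_def)
    have "(\<Sum>j\<in>A. x j * completion x s j) \<le> (\<Sum>j\<in>A. x j * completion x s' j)"
      using 0 start 1 pos
      by (intro sum_mono mult_left_mono) (force simp: completion_def less_imp_le)+
    also have "\<dots> \<le> kk * (\<Sum>j\<in>A. x j * completion x s' j)"
    proof -
      have "0 \<le> (\<Sum>j\<in>A. x j * completion x s' j)"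
        using 0 pos by (intro sum_nonneg mult_nonneg_nonneg) (auto simp: completion_def less_imp_le)
      then show ?thesis
        using mult_right_mono[of 1 kk] by (simp add: kk_def)
    qed
    finally show ?thesis .
  next
    case 2
    then show ?thesis
      using unit_ratio_bound_small[OF greedy pos int a opt] load start by auto
  next
    case 3
    then show ?thesis
      using unit_ratio_bound_large[OF greedy pos int a opt] load start by auto
  qed
qed

section \<open>From general ratios to level sets\<close>

lemma weighted_sum_nonneg_if_level_sums_nonneg:
  fixes r d :: "'b \<Rightarrow> real"
  assumes "finite A" "\<And>j. j \<in> A \<Longrightarrow> 0 \<le> r j" "\<And>\<theta>. 0 \<le> sum d {j \<in> A. \<theta> \<le> r j}"
  shows "0 \<le> (\<Sum>j\<in>A. r j * d j)"
  using assms
proof (induction "card A" arbitrary: A r rule: less_induct)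
  case less
  show ?case
  proof (cases "A = {}")
    case False
    \<comment> \<open>Abel summation: split off the constant \<open>\<rho>\<close>, which multiplies
      the nonnegative full sum, and recurse on the jobs where \<open>r j - \<rho>\<close> is
      positive.\<close>
    define \<rho> where "\<rho> = Min (r ` A)"
    have fin: "finite (r ` A)" "r ` A \<noteq> {}"
      using less.prems(1) False by auto
    have le: "\<rho> \<le> r j" if "j \<in> A" for j
      using fin that by (simp add: \<rho>_def)
    obtain j0 where j0: "j0 \<in> A" "r j0 = \<rho>"
      using Min_in[OF fin] by (auto simp: \<rho>_def)
    let ?A = "{j \<in> A. \<rho> < r j}"
    have "0 \<le> (\<Sum>j\<in>?A. (r j - \<rho>) * d j)"
    proof (rule less.hyps)
      show "card ?A < card A"
        using j0 less.prems(1) by (intro psubset_card_mono) auto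
      \<comment> \<open>Level sets of the shifted ratios must be level sets of \<open>r\<close>: for
        positive \<theta> shift back; otherwise the set is all of \<open>?A\<close>, the level set
        at the second smallest value.\<close>
      show "0 \<le> sum d {j \<in> ?A. \<theta> \<le> r j - \<rho>}" for \<theta>
      proof (cases "0 < \<theta>")
        case True
        then have "{j \<in> ?A. \<theta> \<le> r j - \<rho>} = {j \<in> A. \<theta> + \<rho> \<le> r j}"
          by auto
        then show ?thesis using less.prems(3) by simp
      next
        case f: False
        show ?thesis
        proof (cases "?A = {}")
          case False
          define \<rho>' where "\<rho>' = Min (r ` ?A)"
          have fin': "finite (r ` ?A)" "r ` ?A \<noteq> {}"
            using less.prems(1) False by auto
          have "\<rho> < \<rho>'"
            using Min_in[OF fin'] by (auto simp: \<rho>'_def)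
          then have "{j \<in> ?A. \<theta> \<le> r j - \<rho>} = {j \<in> A. \<rho>' \<le> r j}"
            using f Min_le[OF fin'(1)] by (fastforce simp: \<rho>'_def)
          then show ?thesis using less.prems(3) by simp
        next
          case True
          then have "{j \<in> ?A. \<theta> \<le> r j - \<rho>} = {}" by blast
          then show ?thesis by (simp only: sum.empty)
        qed
      qed
    qed (use less.prems in auto)
    also have "(\<Sum>j\<in>?A. (r j - \<rho>) * d j) = (\<Sum>j\<in>A. (r j - \<rho>) * d j)"
      using less.prems(1) le by (intro sum.mono_neutral_left) force+
    also have "\<dots> = (\<Sum>j\<in>A. r j * d j) - \<rho> * sum d A"
      by (simp add: left_diff_distrib sum_subtractf sum_distrib_left)
    finally have "\<rho> * sum d A \<le> (\<Sum>j\<in>A. r j * d j)" by simp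
    moreover have "{j \<in> A. \<rho> \<le> r j} = A" using le by auto
    then have "0 \<le> sum d A" using less.prems(3)[of \<rho>] by simp
    moreover have "0 \<le> \<rho>" using less.prems(2) j0 by force
    ultimately show ?thesis
      by (meson mult_nonneg_nonneg order_trans)
  qed simp
qed

lemma list_schedule_bound:
  assumes list: "list_schedule m n a r x s" and feas: "feasible_schedule m n a x s"
    and opt: "feasible_schedule m n a x s'"
    and pos: "\<And>j. j < n \<Longrightarrow> 0 < x j" and int: "\<And>j. j < n \<Longrightarrow> x j \<in> \<int>"
    and a: "\<And>i. i < m \<Longrightarrow> a i \<in> {0, 1}" and r: "\<And>j. j < n \<Longrightarrow> 0 \<le> r j"
  shows "(\<Sum>j<n. r j * x j * completion x s j) \<le> kk * (\<Sum>j<n. r j * x j * completion x s' j)"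
proof -
  have "0 \<le> (\<Sum>j<n. r j * (kk * (x j * completion x s' j) - x j * completion x s j))"
  proof (rule weighted_sum_nonneg_if_level_sums_nonneg)
    fix \<theta> :: real
    let ?A = "{j \<in> {..<n}. \<theta> \<le> r j}"
    have "greedy_on m a x ?A s"
      unfolding greedy_on_def
    proof (intro allI impI ballI)
      fix t i j
      assume i: "i < m" and t: "a i \<le> t \<and>
        \<not> (\<exists>k\<in>?A. machine s k = i \<and> start s k \<le> t \<and> t < completion x s k)" and j: "j \<in> ?A"
      show "start s j \<le> t"
      proof (cases "busy n x s i t")
        case True
        then obtain k where k: "k < n" "machine s k = i" "start s k \<le> t" "t < completion x s k"
          by (auto simp: busy_def)
        \<comment> \<open>A job \<open>k\<close> outside the level set has lower priority than
          \<open>j\<close>, so \<open>j\<close> starts no later than \<open>k\<close>.\<close>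
        then have "r k < r j" using t j by fastforce
        then have "start s j \<le> start s k"
          using list j k(1) unfolding list_schedule_def by fastforce
        then show ?thesis using k by simp
      next
        case False
        then show ?thesis
          using list i t j unfolding list_schedule_def by blast
      qed
    qed
    then have "(\<Sum>j\<in>?A. x j * completion x s j) \<le> kk * (\<Sum>j\<in>?A. x j * completion x s' j)"
      using feas opt pos int
      by (intro unit_ratio_bound[OF _ _ _ _ _ a])
        (auto simp: feasible_on_def feasible_schedule_def)
    then show "0 \<le> (\<Sum>j\<in>?A. kk * (x j * completion x s' j) - x j * completion x s j)"
      by (simp add: sum_subtractf sum_distrib_left)
  qed (use r in auto)
  then show ?thesis
    by (simp add: right_diff_distrib sum_subtractf sum_distrib_left mult_ac)
qed

subsection \<open>Independence of start times and processing times\<close>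

text \<open>One inclusion only; exchanging \<open>x\<close> and \<open>y\<close> gives the other.
  Earlier decisions determine the jobs started before \<open>t\<close>. Lengths being positive, a
  job completed by \<open>t\<close> started strictly earlier, hence is not \<open>j\<close>.\<close>

lemma history_subset:
  assumes x: "x \<in> realizations n" and ja: "\<And>k. k < n \<Longrightarrow> k \<noteq> j \<Longrightarrow> x k = y k"
    and T: "t \<le> start (\<pi> x) j"
    and eq: "\<And>t'. t' < t \<Longrightarrow> decisions n \<pi> x t' = decisions n \<pi> y t'"
  shows "fst (history n \<pi> x t) \<subseteq> fst (history n \<pi> y t)"
    and "snd (history n \<pi> x t) \<subseteq> snd (history n \<pi> y t)"
proof -
  have started: "machine (\<pi> x) k = machine (\<pi> y) k \<and> start (\<pi> x) k = start (\<pi> y) k"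
    if "k < n" "start (\<pi> x) k < t" for k
  proof -
    have "(k, machine (\<pi> x) k) \<in> decisions n \<pi> x (start (\<pi> x) k)"
      using that by (auto simp: decisions_def)
    then have "(k, machine (\<pi> x) k) \<in> decisions n \<pi> y (start (\<pi> x) k)"
      using eq[OF that(2)] by simp
    then show ?thesis
      by (auto simp: decisions_def)
  qed
  then show "fst (history n \<pi> x t) \<subseteq> fst (history n \<pi> y t)"
    by (auto simp: history_def)
  show "snd (history n \<pi> x t) \<subseteq> snd (history n \<pi> y t)"
  proof
    fix q assume "q \<in> snd (history n \<pi> x t)"
    then obtain k where k: "q = (k, x k)" "k < n" "start (\<pi> x) k + x k \<le> t"
      by (auto simp: history_def completion_def)
    have "0 < x k"
      using x k by (auto simp: realizations_def)
    then have "start (\<pi> x) k < t" "k \<noteq> j"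
      using k T by auto
    then show "q \<in> snd (history n \<pi> y t)"
      using started[OF k(2)] ja[OF k(2)] k by (auto simp: history_def completion_def)
  qed
qed

text \<open>
  Up to the time at which job \<open>j\<close> is started in one of the two realizations, they produce the
  same history, as nothing is learned about \<open>j\<close> before.
\<close>

lemma start_eq_if_agree_elsewhere:
  assumes na: "non_anticipatory n \<pi>" and x: "x \<in> realizations n" and y: "y \<in> realizations n"
    and eq: "\<And>k. k < n \<Longrightarrow> k \<noteq> j \<Longrightarrow> x k = y k" and j: "j < n"
  shows "start (\<pi> x) j = start (\<pi> y) j"
proof -
  define T where "T = min (start (\<pi> x) j) (start (\<pi> y) j)"
  define D where "D = {t. t \<le> T \<and> decisions n \<pi> x t \<noteq> decisions n \<pi> y t}"
  \<comment> \<open>Decisions are empty except at start times, so although time is continuous there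
    is a first disagreement.\<close>
  have "D \<subseteq> start (\<pi> x) ` {..<n} \<union> start (\<pi> y) ` {..<n}"
    by (auto simp: D_def decisions_def)
  then have "finite D"
    by (rule finite_subset) auto
  have "D = {}"
  proof (rule ccontr)
    assume "D \<noteq> {}"
    define t where "t = Min D"
    have t: "t \<le> T" "decisions n \<pi> x t \<noteq> decisions n \<pi> y t"
      using Min_in[OF \<open>finite D\<close> \<open>D \<noteq> {}\<close>] by (auto simp: D_def t_def)
    have before: "decisions n \<pi> x t' = decisions n \<pi> y t'" if "t' < t" for t'
      using that t(1) Min_le[OF \<open>finite D\<close>, of t'] by (force simp: D_def t_def)
    have le: "t \<le> start (\<pi> x) j" "t \<le> start (\<pi> y) j"
      using t(1) by (auto simp: T_def)
    have sub: "fst (history n \<pi> x t) \<subseteq> fst (history n \<pi> y t)"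
      "snd (history n \<pi> x t) \<subseteq> snd (history n \<pi> y t)"
      by (rule history_subset[where j = j]; (rule x eq le before; assumption))+
    have sup: "fst (history n \<pi> y t) \<subseteq> fst (history n \<pi> x t)"
      "snd (history n \<pi> y t) \<subseteq> snd (history n \<pi> x t)"
      by (rule history_subset[where j = j]; (rule y eq[symmetric] le before[symmetric]; assumption))+
    have "history n \<pi> x t = history n \<pi> y t"
      by (rule prod_eqI; rule subset_antisym; rule sub sup)
    then have "decisions n \<pi> x t = decisions n \<pi> y t"
      using na x y unfolding non_anticipatory_def by blast
    then show False
      using t(2) by contradiction
  qed
  then have same: "decisions n \<pi> x T = decisions n \<pi> y T"
    by (auto simp: D_def)
  show ?thesis
  proof (cases "start (\<pi> x) j \<le> start (\<pi> y) j")
    case True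
    then have "(j, machine (\<pi> x) j) \<in> decisions n \<pi> x T"
      using j by (auto simp: decisions_def T_def)
    then show ?thesis
      unfolding same using True by (auto simp: decisions_def T_def)
  next
    case False
    then have "(j, machine (\<pi> y) j) \<in> decisions n \<pi> y T"
      using j by (auto simp: decisions_def T_def)
    then show ?thesis
      unfolding same[symmetric] using False by (auto simp: decisions_def T_def)
  qed
qed

text \<open>
  Rounding changes processing times only on a null set, and it makes the start times of an arbitrary
  policy measurable, as they become functions on a countable space.
\<close>

definition pos_nat :: "real \<Rightarrow> nat" where
  "pos_nat u = (if u \<in> \<int> \<and> 0 < u then nat \<lfloor>u\<rfloor> else 1)"

lemma pos_nat_pos: "0 < pos_nat u"
  by (auto simp: pos_nat_def Ints_def)

lemma real_pos_nat: "u \<in> \<int> \<Longrightarrow> 0 < u \<Longrightarrow> real (pos_nat u) = u"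
  by (auto simp: pos_nat_def Ints_def)

lemma measurable_pos_nat [measurable]: "pos_nat \<in> borel \<rightarrow>\<^sub>M count_space UNIV"
proof -
  have "(\<int> \<inter> {0<..} :: real set) \<in> sets borel"
    by (rule sets.Int) (auto intro: borel_closed)
  then have "(\<lambda>u. if u \<in> \<int> \<inter> {0<..} then nat \<lfloor>u\<rfloor> else 1) \<in> (borel :: real measure) \<rightarrow>\<^sub>M count_space UNIV"
    by (intro measurable_If_set) auto
  then show ?thesis
    by (simp add: pos_nat_def[abs_def])
qed

text \<open>Entries from \<open>n\<close> on are frozen, so that the vector a policy sees is a
  function of finitely many natural numbers.\<close>

definition rounded :: "nat \<Rightarrow> (nat \<Rightarrow> 'a \<Rightarrow> real) \<Rightarrow> 'a \<Rightarrow> realization" where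
  "rounded n X \<omega> = (\<lambda>k. if k < n then real (pos_nat (X k \<omega>)) else 1)"

lemma rounded_realizations: "rounded n X \<omega> \<in> realizations n"
  by (auto simp: rounded_def realizations_def pos_nat_pos)

context prob_space
begin

text \<open>A finite power of the discrete space of naturals is discrete, so every function on it is
  measurable.\<close>

lemma measurable_start:
  assumes ind: "indep_vars (\<lambda>_. borel) X {..<n}"
  shows "(\<lambda>\<omega>. ennreal (start (\<pi> (rounded n X \<omega>)) j)) \<in> borel_measurable M"
proof -
  let ?P = "PiM {..<n} (\<lambda>_. count_space UNIV) :: (nat \<Rightarrow> nat) measure"
  define G where "G z = ennreal (start (\<pi> (\<lambda>k. if k < n then real (z k) else 1)) j)" for z :: "nat \<Rightarrow> nat"
  have "?P = count_space (PiE {..<n} (\<lambda>_. UNIV))"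
    by (rule count_space_PiM_finite) auto
  then have G: "G \<in> ?P \<rightarrow>\<^sub>M borel"
    by simp
  have "random_variable borel (X k)" if "k < n" for k
    using ind that by (auto simp: indep_vars_def)
  then have "(\<lambda>\<omega>. \<lambda>k\<in>{..<n}. pos_nat (X k \<omega>)) \<in> M \<rightarrow>\<^sub>M ?P"
    by (intro measurable_restrict measurable_compose[OF _ measurable_pos_nat]) auto
  then have "(\<lambda>\<omega>. G (\<lambda>k\<in>{..<n}. pos_nat (X k \<omega>))) \<in> borel_measurable M"
    by (rule measurable_compose[OF _ G])
  moreover have "(\<lambda>k. if k < n then real ((\<lambda>k\<in>{..<n}. pos_nat (X k \<omega>)) k) else 1) = rounded n X \<omega>" for \<omega>
    by (auto simp: rounded_def)
  ultimately show ?thesis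
    by (simp add: G_def)
qed

text \<open>By \<open>start_eq_if_agree_elsewhere\<close> the start of \<open>j\<close> is unchanged
  when entry \<open>j\<close> is set to 1, which makes it a function \<open>G\<close> of the other
  processing times.\<close>

lemma nn_integral_mult_start:
  assumes ind: "indep_vars (\<lambda>_. borel) X {..<n}" and na: "non_anticipatory n \<pi>" and j: "j < n"
  shows "(\<integral>\<^sup>+\<omega>. ennreal (rounded n X \<omega> j) * ennreal (start (\<pi> (rounded n X \<omega>)) j) \<partial>M)
    = (\<integral>\<^sup>+\<omega>. ennreal (rounded n X \<omega> j) \<partial>M) * (\<integral>\<^sup>+\<omega>. ennreal (start (\<pi> (rounded n X \<omega>)) j) \<partial>M)"
proof -
  let ?c = "\<lambda>_. count_space UNIV :: nat measure"
  let ?B = "{..<n} - {j}"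
  define N where "N k \<omega> = pos_nat (X k \<omega>)" for k \<omega>
  define F where "F z = ennreal (real (z j))" for z :: "nat \<Rightarrow> nat"
  define G where "G z = ennreal (start (\<pi> (\<lambda>k. if k \<in> ?B then real (z k) else 1)) j)" for z :: "nat \<Rightarrow> nat"
  have "indep_vars ?c N {..<n}"
    unfolding N_def by (rule indep_vars_compose2[OF ind]) simp
  then have 1: "indep_var (PiM {j} ?c) (\<lambda>\<omega>. \<lambda>i\<in>{j}. N i \<omega>) (PiM ?B ?c) (\<lambda>\<omega>. \<lambda>i\<in>?B. N i \<omega>)"
    using j by (intro indep_var_restrict) auto
  have "PiM {j} ?c = count_space (PiE {j} (\<lambda>_. UNIV))"
    "PiM ?B ?c = count_space (PiE ?B (\<lambda>_. UNIV))"
    by (rule count_space_PiM_finite; simp)+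
  then have "F \<in> PiM {j} ?c \<rightarrow>\<^sub>M borel" "G \<in> PiM ?B ?c \<rightarrow>\<^sub>M borel"
    by simp_all
  note indep_var_compose[OF 1 this]
  moreover have "F \<circ> (\<lambda>\<omega>. \<lambda>i\<in>{j}. N i \<omega>) = (\<lambda>\<omega>. ennreal (rounded n X \<omega> j))"
    using j by (auto simp: F_def N_def rounded_def)
  moreover have "G \<circ> (\<lambda>\<omega>. \<lambda>i\<in>?B. N i \<omega>) = (\<lambda>\<omega>. ennreal (start (\<pi> (rounded n X \<omega>)) j))"
  proof
    fix \<omega>
    have "start (\<pi> (\<lambda>k. if k \<in> ?B then real ((\<lambda>i\<in>?B. N i \<omega>) k) else 1)) j = start (\<pi> (rounded n X \<omega>)) j"
      by (rule start_eq_if_agree_elsewhere[OF na])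
        (auto simp: rounded_def N_def realizations_def pos_nat_pos j)
    then show "(G \<circ> (\<lambda>\<omega>. \<lambda>i\<in>?B. N i \<omega>)) \<omega> = ennreal (start (\<pi> (rounded n X \<omega>)) j)"
      by (simp only: G_def o_def)
  qed
  ultimately have "indep_var borel (\<lambda>\<omega>. ennreal (rounded n X \<omega> j))
      borel (\<lambda>\<omega>. ennreal (start (\<pi> (rounded n X \<omega>)) j))"
    by simp
  then have "indep_vars (\<lambda>_. borel) (case_bool (\<lambda>\<omega>. ennreal (rounded n X \<omega> j))
      (\<lambda>\<omega>. ennreal (start (\<pi> (rounded n X \<omega>)) j))) UNIV"
    unfolding indep_var_def by (rule back_subst[where P="\<lambda>N. indep_vars N _ _"]) (auto split: bool.split)
  from indep_vars_nn_integral[OF _ this] show ?thesis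
    by (simp add: UNIV_bool mult.commute)
qed

end

lemma nn_integral_weighted_sums:
  assumes "finite A" "\<And>j. j \<in> A \<Longrightarrow> f j \<in> borel_measurable M" "\<And>j. j \<in> A \<Longrightarrow> g j \<in> borel_measurable M"
  shows "(\<integral>\<^sup>+\<omega>. (\<Sum>j\<in>A. c j * f j \<omega>) + (\<Sum>j\<in>A. c j * g j \<omega>) \<partial>M)
    = (\<Sum>j\<in>A. c j * (\<integral>\<^sup>+\<omega>. f j \<omega> \<partial>M)) + (\<Sum>j\<in>A. c j * (\<integral>\<^sup>+\<omega>. g j \<omega> \<partial>M))"
  using assms by (simp add: nn_integral_add nn_integral_sum nn_integral_cmult cong: sum.cong_simp)

subsection \<open>The stochastic bound\<close>

theorem theorem8:
  fixes M :: "'a measure" and m n :: nat and a w :: "nat \<Rightarrow> real"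
    and X :: "nat \<Rightarrow> 'a \<Rightarrow> real" and \<Delta> :: real and \<sigma> \<pi> :: policy
  assumes "prob_space M"
    and "\<And>i. i < m \<Longrightarrow> a i \<in> {0, 1}"
    and "\<And>j. j < n \<Longrightarrow> 0 < w j"
    and "prob_space.indep_vars M (\<lambda>_. borel) X {..<n}"
    and "\<And>j. j < n \<Longrightarrow> AE \<omega> in M. 0 < X j \<omega>"
    and "\<And>j. j < n \<Longrightarrow> AE \<omega> in M. X j \<omega> \<in> \<int>"
    and "\<And>j. j < n \<Longrightarrow> integrable M (\<lambda>\<omega>. (X j \<omega>)\<^sup>2)"
    and "0 \<le> \<Delta>"
    and "\<And>j. j < n \<Longrightarrow>
           prob_space.variance M (X j) \<le> \<Delta> * (prob_space.expectation M (X j))\<^sup>2"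
    and "WSEPT M m n a w X \<sigma>"
    and "nonpreemptive_policy m n a \<pi>"
  shows "expected_cost M n w X \<sigma>
           \<le> ennreal (1 + 1 / 2 * (sqrt 2 - 1) * (1 + \<Delta>)) * expected_cost M n w X \<pi>"
proof -
  interpret prob_space M by fact
  note a = assms(2) and w = assms(3) and ind = assms(4)
  define Y where "Y = rounded n X"
  define \<mu> where "\<mu> j = expectation (X j)" for j
  define V where "V j = expectation (\<lambda>\<omega>. (X j \<omega>)\<^sup>2)" for j
  define r where "r j = w j / \<mu> j" for j
  define ES where "ES p j = (\<integral>\<^sup>+\<omega>. ennreal (start (p (Y \<omega>)) j) \<partial>M)" for p :: policy and j
  have meas: "X j \<in> borel_measurable M" if "j < n" for j
    using ind that by (auto simp: indep_vars_def)
  have int: "integrable M (X j)" if "j < n" for j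
    by (rule square_integrable_imp_integrable[OF meas[OF that] assms(7)[OF that]])
  have Y: "Y \<omega> \<in> realizations n" "j < n \<Longrightarrow> Y \<omega> j \<in> \<int>" "j < n \<Longrightarrow> 0 < Y \<omega> j" for \<omega> j
    unfolding Y_def using rounded_realizations by (auto simp: rounded_def pos_nat_pos)
  have XY1: "AE \<omega> in M. X j \<omega> = Y \<omega> j" if "j < n" for j
    using assms(5)[OF that] assms(6)[OF that]
    by eventually_elim (simp add: Y_def rounded_def that real_pos_nat)
  have "AE \<omega> in M. \<forall>j\<in>{..<n}. X j \<omega> = Y \<omega> j"
    using XY1 by (intro AE_finite_allI) auto
  then have XY: "AE \<omega> in M. \<forall>j<n. X j \<omega> = Y \<omega> j"
    by eventually_elim blast
  have EY: "(\<integral>\<^sup>+\<omega>. ennreal (Y \<omega> j) \<partial>M) = ennreal (\<mu> j)" if "j < n" for j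
  proof -
    have "(\<integral>\<^sup>+\<omega>. ennreal (Y \<omega> j) \<partial>M) = (\<integral>\<^sup>+\<omega>. ennreal (X j \<omega>) \<partial>M)"
      using XY1[OF that] by (intro nn_integral_cong_AE) auto
    also have "\<dots> = ennreal (\<mu> j)"
      unfolding \<mu>_def using int[OF that] assms(5)[OF that] by (intro nn_integral_eq_integral) auto
    finally show ?thesis .
  qed
  have EY2: "(\<integral>\<^sup>+\<omega>. ennreal ((Y \<omega> j)\<^sup>2) \<partial>M) = ennreal (V j)" if "j < n" for j
  proof -
    have "(\<integral>\<^sup>+\<omega>. ennreal ((Y \<omega> j)\<^sup>2) \<partial>M) = (\<integral>\<^sup>+\<omega>. ennreal ((X j \<omega>)\<^sup>2) \<partial>M)"
      using XY1[OF that] by (intro nn_integral_cong_AE) auto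
    also have "\<dots> = ennreal (V j)"
      unfolding V_def using assms(7)[OF that] by (intro nn_integral_eq_integral) auto
    finally show ?thesis .
  qed
  have \<mu>: "0 < \<mu> j" if "j < n" for j
    unfolding \<mu>_def using expectation_greater[OF int[OF that] assms(5)[OF that]] by simp
  have r: "0 < r j" "r j * \<mu> j = w j" if "j < n" for j
    using w[OF that] \<mu>[OF that] by (auto simp: r_def)
  have V: "V j \<le> (1 + \<Delta>) * (\<mu> j)\<^sup>2" "0 \<le> V j" if "j < n" for j
    using variance_eq[OF int[OF that] assms(7)[OF that]] assms(9)[OF that]
    by (auto simp: V_def \<mu>_def algebra_simps)
  have measY: "(\<lambda>\<omega>. ennreal (Y \<omega> j)) \<in> borel_measurable M"
    "(\<lambda>\<omega>. ennreal ((Y \<omega> j)\<^sup>2)) \<in> borel_measurable M" if "j < n" for j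
    using meas[OF that] that unfolding Y_def rounded_def by simp_all
  have measS: "(\<lambda>\<omega>. ennreal (start (p (Y \<omega>)) j)) \<in> borel_measurable M" for p j
    unfolding Y_def by (rule measurable_start[OF ind])
  have S0: "0 \<le> start (p (Y \<omega>)) j" if "nonpreemptive_policy m n a p" "j < n" for p \<omega> j
  proof -
    have "machine (p (Y \<omega>)) j < m" "a (machine (p (Y \<omega>)) j) \<le> start (p (Y \<omega>)) j"
      using that Y(1)[of \<omega>] by (auto simp: nonpreemptive_policy_def feasible_schedule_def)
    then show ?thesis
      using a[of "machine (p (Y \<omega>)) j"] by auto
  qed

  have cost: "expected_cost M n w X p = (\<Sum>j<n. ennreal (w j) * ES p j) + (\<Sum>j<n. ennreal (w j * \<mu> j))"
    if p: "nonpreemptive_policy m n a p" for p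
  proof -
    have "expected_cost M n w X p
        = (\<integral>\<^sup>+\<omega>. (\<Sum>j<n. ennreal (w j) * ennreal (start (p (Y \<omega>)) j))
            + (\<Sum>j<n. ennreal (w j) * ennreal (Y \<omega> j)) \<partial>M)"
      unfolding expected_cost_def
    proof (rule nn_integral_cong_AE)
      show "AE \<omega> in M. ennreal (\<Sum>j<n. w j * completion (\<lambda>j. X j \<omega>) (p (\<lambda>j. X j \<omega>)) j)
          = (\<Sum>j<n. ennreal (w j) * ennreal (start (p (Y \<omega>)) j))
            + (\<Sum>j<n. ennreal (w j) * ennreal (Y \<omega> j))"
        using XY
      proof eventually_elim
        case (elim \<omega>)
        then have "(\<lambda>j. X j \<omega>) \<in> realizations n"
          using Y(3) by (auto simp: realizations_def)
        \<comment> \<open>The two vectors agree only below \<open>n\<close>; that the policy ignores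
          the rest follows from non-anticipation.\<close>
        then have "start (p (\<lambda>j. X j \<omega>)) j = start (p (Y \<omega>)) j" if "j < n" for j
          using p elim Y(1) that
          by (intro start_eq_if_agree_elsewhere) (auto simp: nonpreemptive_policy_def)
        then have "(\<Sum>j<n. w j * completion (\<lambda>j. X j \<omega>) (p (\<lambda>j. X j \<omega>)) j)
            = (\<Sum>j<n. w j * start (p (Y \<omega>)) j + w j * Y \<omega> j)"
          using elim by (intro sum.cong) (auto simp: completion_def distrib_left)
        also have "ennreal \<dots> = (\<Sum>j<n. ennreal (w j * start (p (Y \<omega>)) j + w j * Y \<omega> j))"
          using S0[OF p] w Y(3) by (intro sum_ennreal[symmetric]) (auto simp: less_imp_le)
        also have "\<dots> = (\<Sum>j<n. ennreal (w j) * ennreal (start (p (Y \<omega>)) j) + ennreal (w j) * ennreal (Y \<omega> j))"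
          using S0[OF p] w Y(3) by (intro sum.cong) (auto simp: less_imp_le ennreal_mult)
        finally show ?case by (simp add: sum.distrib)
      qed
    qed
    also have "\<dots> = (\<Sum>j<n. ennreal (w j) * ES p j) + (\<Sum>j<n. ennreal (w j) * ennreal (\<mu> j))"
      using measY measS by (subst nn_integral_weighted_sums) (auto simp: EY ES_def)
    also have "(\<Sum>j<n. ennreal (w j) * ennreal (\<mu> j)) = (\<Sum>j<n. ennreal (w j * \<mu> j))"
      using w \<mu> by (intro sum.cong) (auto simp: less_imp_le ennreal_mult)
    finally show ?thesis .
  qed

  have integrand: "ennreal (\<Sum>j<n. r j * Y \<omega> j * completion (Y \<omega>) (p (Y \<omega>)) j)
      = (\<Sum>j<n. ennreal (r j) * (ennreal (Y \<omega> j) * ennreal (start (p (Y \<omega>)) j)))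
        + (\<Sum>j<n. ennreal (r j) * ennreal ((Y \<omega> j)\<^sup>2))"
    if p: "nonpreemptive_policy m n a p" for p \<omega>
  proof -
    have "ennreal (\<Sum>j<n. r j * Y \<omega> j * completion (Y \<omega>) (p (Y \<omega>)) j)
        = (\<Sum>j<n. ennreal (r j * Y \<omega> j * completion (Y \<omega>) (p (Y \<omega>)) j))"
      using S0[OF p] r Y(3) by (intro sum_ennreal[symmetric]) (auto simp: completion_def less_imp_le)
    also have "\<dots> = (\<Sum>j<n. ennreal (r j) * (ennreal (Y \<omega> j) * ennreal (start (p (Y \<omega>)) j))
          + ennreal (r j) * ennreal ((Y \<omega> j)\<^sup>2))"
    proof (rule sum.cong)
      fix j assume "j \<in> {..<n}"
      then have nn: "0 \<le> r j" "0 \<le> Y \<omega> j" "0 \<le> start (p (Y \<omega>)) j"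
        using r Y(3) S0[OF p] by (auto simp: less_imp_le)
      have "r j * Y \<omega> j * completion (Y \<omega>) (p (Y \<omega>)) j
          = r j * (Y \<omega> j * start (p (Y \<omega>)) j) + r j * (Y \<omega> j)\<^sup>2"
        by (simp add: completion_def power2_eq_square algebra_simps)
      then show "ennreal (r j * Y \<omega> j * completion (Y \<omega>) (p (Y \<omega>)) j)
          = ennreal (r j) * (ennreal (Y \<omega> j) * ennreal (start (p (Y \<omega>)) j))
            + ennreal (r j) * ennreal ((Y \<omega> j)\<^sup>2)"
        using nn by (simp add: ennreal_mult)
    qed simp
    finally show ?thesis
      by (simp add: sum.distrib)
  qed

  text \<open>Since \<open>w j = r j * \<mu> j\<close>, independence lets the weight \<open>w j\<close> of a start time be replaced
    by \<open>r j\<close> times the realized processing time.\<close>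
  have integral_eq: "(\<integral>\<^sup>+\<omega>. ennreal (\<Sum>j<n. r j * Y \<omega> j * completion (Y \<omega>) (p (Y \<omega>)) j) \<partial>M)
      = (\<Sum>j<n. ennreal (w j) * ES p j) + (\<Sum>j<n. ennreal (r j * V j))"
    if p: "nonpreemptive_policy m n a p" for p
  proof -
    have "(\<integral>\<^sup>+\<omega>. ennreal (\<Sum>j<n. r j * Y \<omega> j * completion (Y \<omega>) (p (Y \<omega>)) j) \<partial>M)
       = (\<integral>\<^sup>+\<omega>. (\<Sum>j<n. ennreal (r j) * (ennreal (Y \<omega> j) * ennreal (start (p (Y \<omega>)) j)))
            + (\<Sum>j<n. ennreal (r j) * ennreal ((Y \<omega> j)\<^sup>2)) \<partial>M)"
      by (simp only: integrand[OF p])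
    also have "\<dots> = (\<Sum>j<n. ennreal (r j) * (\<integral>\<^sup>+\<omega>. ennreal (Y \<omega> j) * ennreal (start (p (Y \<omega>)) j) \<partial>M))
        + (\<Sum>j<n. ennreal (r j) * ennreal (V j))"
      using measY measS by (subst nn_integral_weighted_sums) (auto simp: EY2 intro!: borel_measurable_times_ennreal)
    also have "(\<Sum>j<n. ennreal (r j) * (\<integral>\<^sup>+\<omega>. ennreal (Y \<omega> j) * ennreal (start (p (Y \<omega>)) j) \<partial>M))
        = (\<Sum>j<n. ennreal (w j) * ES p j)"
    proof (rule sum.cong)
      fix j assume "j \<in> {..<n}"
      then have j: "j < n" by simp
      have na: "non_anticipatory n p" using p by (simp add: nonpreemptive_policy_def)
      have "(\<integral>\<^sup>+\<omega>. ennreal (Y \<omega> j) * ennreal (start (p (Y \<omega>)) j) \<partial>M) = ennreal (\<mu> j) * ES p j"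
        using nn_integral_mult_start[OF ind na j] EY[OF j] by (simp add: Y_def ES_def)
      moreover have "ennreal (w j) = ennreal (r j) * ennreal (\<mu> j)"
        using r[OF j] \<mu>[OF j] ennreal_mult[of "r j" "\<mu> j"] by (simp add: less_imp_le)
      ultimately show "ennreal (r j) * (\<integral>\<^sup>+\<omega>. ennreal (Y \<omega> j) * ennreal (start (p (Y \<omega>)) j) \<partial>M)
          = ennreal (w j) * ES p j"
        by (simp add: mult.assoc)
    qed simp
    also have "(\<Sum>j<n. ennreal (r j) * ennreal (V j)) = (\<Sum>j<n. ennreal (r j * V j))"
      using r V by (intro sum.cong) (auto simp: less_imp_le ennreal_mult)
    finally show ?thesis .
  qed

  have \<sigma>: "nonpreemptive_policy m n a \<sigma>" and \<pi>: "nonpreemptive_policy m n a \<pi>"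
    using assms(10,11) by (auto simp: WSEPT_def)
  define C where "C p = (\<Sum>j<n. ennreal (w j) * ES p j)" for p
  \<comment> \<open>\<open>V1\<close> is the part of the cost that no policy influences,
    \<open>V2\<close> its analogue for the random weights. They are related by \<open>V j\<close>
    being variance plus squared mean.\<close>
  define V1 where "V1 = (\<Sum>j<n. w j * \<mu> j)"
  define V2 where "V2 = (\<Sum>j<n. r j * V j)"
  have kk: "1 < kk" by (simp add: kk_def)
  have V1: "(\<Sum>j<n. ennreal (w j * \<mu> j)) = ennreal V1" "0 \<le> V1"
    unfolding V1_def using w \<mu> by (auto intro!: sum_ennreal sum_nonneg simp: less_imp_le)
  have V2: "(\<Sum>j<n. ennreal (r j * V j)) = ennreal V2" "0 \<le> V2"
    unfolding V2_def using r V by (auto intro!: sum_ennreal sum_nonneg simp: less_imp_le)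
  have "V2 \<le> (\<Sum>j<n. r j * ((1 + \<Delta>) * (\<mu> j)\<^sup>2))"
    unfolding V2_def using r V by (intro sum_mono mult_left_mono) (auto simp: less_imp_le)
  also have "\<dots> = (\<Sum>j<n. (1 + \<Delta>) * (r j * \<mu> j * \<mu> j))"
    by (intro sum.cong) (auto simp: power2_eq_square)
  also have "\<dots> = (1 + \<Delta>) * V1"
    unfolding V1_def using r by (simp add: sum_distrib_left)
  finally have V21: "V2 \<le> (1 + \<Delta>) * V1" .

  have "(\<Sum>j<n. r j * Y \<omega> j * completion (Y \<omega>) (\<sigma> (Y \<omega>)) j)
      \<le> kk * (\<Sum>j<n. r j * Y \<omega> j * completion (Y \<omega>) (\<pi> (Y \<omega>)) j)" for \<omega>
    using assms(10) \<sigma> \<pi> Y a r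
    by (intro list_schedule_bound[where m = m and a = a])
      (auto simp: WSEPT_def nonpreemptive_policy_def r_def[abs_def] \<mu>_def[abs_def] less_imp_le)
  then have "C \<sigma> + ennreal V2
      \<le> (\<integral>\<^sup>+\<omega>. ennreal (kk * (\<Sum>j<n. r j * Y \<omega> j * completion (Y \<omega>) (\<pi> (Y \<omega>)) j)) \<partial>M)"
    unfolding C_def V2(1)[symmetric] integral_eq[OF \<sigma>, symmetric]
    by (intro nn_integral_mono ennreal_leI)
  also have "\<dots> = (\<integral>\<^sup>+\<omega>. ennreal kk * ennreal (\<Sum>j<n. r j * Y \<omega> j * completion (Y \<omega>) (\<pi> (Y \<omega>)) j) \<partial>M)"
    using kk by (simp add: ennreal_mult')
  also have "\<dots> = ennreal kk * (\<integral>\<^sup>+\<omega>. ennreal (\<Sum>j<n. r j * Y \<omega> j * completion (Y \<omega>) (\<pi> (Y \<omega>)) j) \<partial>M)"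
    using measY measS unfolding integrand[OF \<pi>]
    by (intro nn_integral_cmult borel_measurable_add borel_measurable_sum borel_measurable_times_ennreal)
      auto
  also have "\<dots> = ennreal kk * (C \<pi> + ennreal V2)"
    unfolding C_def V2(1)[symmetric] integral_eq[OF \<pi>] ..
  finally have main: "C \<sigma> + ennreal V2 \<le> ennreal kk * (C \<pi> + ennreal V2)" .
  have const: "1 + 1 / 2 * (sqrt 2 - 1) * (1 + \<Delta>) = 1 + (kk - 1) * (1 + \<Delta>)" (is "?c = _")
    by (simp add: kk_def field_simps)
  have "0 \<le> (kk - 1) * \<Delta>"
    using kk assms(8) by simp
  then have "kk \<le> ?c"
    unfolding const by (simp add: distrib_left)
  with kk have c: "kk \<le> ?c" "1 \<le> ?c"
    by simp_all
  have "C \<sigma> + ennreal V1 \<le> ennreal ?c * (C \<pi> + ennreal V1)"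
  proof (cases "C \<pi>")
    case top
    then show ?thesis using c by (simp add: ennreal_mult_top)
  next
    \<comment> \<open>Cancelling \<open>V2\<close> requires finite costs, so the argument moves to
      the reals.\<close>
    case (real A)
    then have "C \<sigma> + ennreal V2 \<le> ennreal (kk * (A + V2))"
      using main kk V2 by (simp add: ennreal_mult' flip: ennreal_plus)
    then have "C \<sigma> < top"
      by (metis ennreal_add_eq_top ennreal_less_top le_less_trans less_top)
    then obtain B where B: "C \<sigma> = ennreal B" "0 \<le> B"
      by (cases "C \<sigma>") auto
    have "B + V2 \<le> kk * (A + V2)"
      using \<open>C \<sigma> + ennreal V2 \<le> ennreal (kk * (A + V2))\<close> B V2 kk real
      by (simp flip: ennreal_plus add: ennreal_le_iff)
    moreover have "(kk - 1) * V2 \<le> (kk - 1) * ((1 + \<Delta>) * V1)"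
      using kk V21 by (intro mult_left_mono) auto
    moreover have "kk * A \<le> ?c * A"
      using c real by (intro mult_right_mono) auto
    \<comment> \<open>Subtracting \<open>V2\<close> leaves
      \<open>B \<le> kk * A + (kk - 1) * V2\<close>, and \<open>V2\<close> is at most
      \<open>(1 + \<Delta>) * V1\<close>.\<close>
    ultimately have "B + V1 \<le> ?c * (A + V1)"
      unfolding const by (simp add: algebra_simps)
    then show ?thesis
      using B real V1 c by (simp add: ennreal_leI flip: ennreal_plus ennreal_mult)
  qed
  then show ?thesis
    by (simp add: cost[OF \<sigma>] cost[OF \<pi>] V1 C_def)
qed

end
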